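(* Consider the Gaussian sequence model $X_i=\theta_i+\varepsilon_i$, $1\le i\le n$, $\varepsilon_i$ i.i.d. $\mathcal N(0,1)$, and for $\beta\in(0,1)$ the class (with fixed $0<a<b$) $$\Theta(r,\beta)=\bigcup_{s_n\in[an^{1-\beta},\,bn^{1-\beta}]}\{\theta\in\mathbb R^n:\ |S_\theta|=s_n,\ |\theta_i|\ge \sqrt{2r\log n}\ \text{for all } i\in S_\theta\}.$$ Let $r>0$ be given. There exists an estimator $\hat\beta=\hat\beta(X)$ such that, if one sets $$\varphi_i^r=\mathbf 1\Big\{|X_i|\ge\Big(\frac{\sqrt r}{2}+\frac{\hat\beta}{2\sqrt r}\Big)\sqrt{2\log n}\Big\},$$ then for any $\varepsilon>0$ there exists a constant $C=C(\varepsilon)>0$ such that for $n$ large enough, for any $\beta\in[\varepsilon,\min(r,1)-\varepsilon]$, $$\sup_{\theta\in\Theta(r,\beta)}E_\theta L_C(\theta,\varphi^r)\le C\,v_C(r,\beta),\qquad \sup_{\theta\in\Theta(r,\beta)}\mathfrak R(\theta,\varphi^r)\le C\,v_R(r,\beta).$$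
   Context: $\theta\in\mathbb R^n$ is deterministic; $P_\theta,E_\theta$ denote the law of $X$ and its expectation; $S_\theta=\{i:\theta_i\ne0\}$; the union is over integers $s_n$. For $0<\beta<r$, $\kappa=\kappa(r,\beta)$ is defined by $\sqrt{\kappa}=(\sqrt r-\beta/\sqrt r)/2$, and $v_R(r,\beta)=n^{-\kappa}/\sqrt{\log n}$, $v_C(r,\beta)=n^{1-\beta}v_R(r,\beta)$. A multiple testing procedure is a measurable $\varphi:\mathbb R^n\to\{0,1\}^n$. $\mathrm{FDR}(\theta,\varphi)=E_\theta\left[\frac{\sum_i\mathbf 1\{\theta_i=0\}\varphi_i(X)}{1\vee\sum_i\varphi_i(X)}\right]$, $\mathrm{FNR}(\theta,\varphi)=E_\theta\left[\frac{\sum_i\mathbf 1\{\theta_i\ne0\}(1-\varphi_i(X))}{1\vee|S_\theta|}\right]$, $\mathfrak R=\mathrm{FDR}+\mathrm{FNR}$; $L_C(\theta,\varphi)=\sum_{i=1}^n(\mathbf 1\{\theta_i=0\}\mathbf 1\{\varphi_i\ne0\}+\mathbf 1\{\theta_i\ne0\}\mathbf 1\{\varphi_i=0\})$. The estimator $\hat\beta$ is a measurable function of $X$ (and $n$) that does not depend on $\beta$ or $\theta$. *)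

theory Defs
  imports "HOL-Probability.Probability"
begin

text \<open>
  Vectors in \<open>\<real>\<^sup>n\<close> are functions in \<open>{1..n} \<rightarrow>\<^sub>E UNIV\<close>, so that \<open>n\<close> can vary inside a statement.
  The decision \<open>\<phi>\<^sub>i(x) \<in> {0,1}\<close> of a test is a truth value \<open>\<phi> x i\<close>, with \<open>True\<close> standing for 1.
\<close>

type_synonym vec = "nat \<Rightarrow> real"
type_synonym test = "vec \<Rightarrow> nat \<Rightarrow> bool"

definition Rn :: "nat \<Rightarrow> vec measure" where
  "Rn n = (\<Pi>\<^sub>M i\<in>{1..n}. borel)"

definition noise :: "nat \<Rightarrow> vec measure" where
  "noise n = (\<Pi>\<^sub>M i\<in>{1..n}. density lborel std_normal_density)"

definition law :: "nat \<Rightarrow> vec \<Rightarrow> vec measure" where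
  "law n \<theta> = distr (noise n) (Rn n) (\<lambda>e. \<lambda>i\<in>{1..n}. \<theta> i + e i)"

definition supp :: "nat \<Rightarrow> vec \<Rightarrow> nat set" where
  "supp n \<theta> = {i \<in> {1..n}. \<theta> i \<noteq> 0}"

definition Theta :: "real \<Rightarrow> real \<Rightarrow> nat \<Rightarrow> real \<Rightarrow> real \<Rightarrow> vec set" where
  "Theta a b n r \<beta> =
     (\<Union>s \<in> {s::nat. real s \<in> {a * real n powr (1 - \<beta>) .. b * real n powr (1 - \<beta>)}}.
        {\<theta> \<in> {1..n} \<rightarrow>\<^sub>E UNIV. card (supp n \<theta>) = s \<and>
           (\<forall>i\<in>supp n \<theta>. \<bar>\<theta> i\<bar> \<ge> sqrt (2 * r * ln (real n)))})"

definition FDR :: "nat \<Rightarrow> vec \<Rightarrow> test \<Rightarrow> real" where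
  "FDR n \<theta> \<phi> = (\<integral>x. (\<Sum>i=1..n. of_bool (\<theta> i = 0) * of_bool (\<phi> x i))
                     / max 1 (\<Sum>i=1..n. of_bool (\<phi> x i)) \<partial>law n \<theta>)"

definition FNR :: "nat \<Rightarrow> vec \<Rightarrow> test \<Rightarrow> real" where
  "FNR n \<theta> \<phi> = (\<integral>x. (\<Sum>i=1..n. of_bool (\<theta> i \<noteq> 0) * (1 - of_bool (\<phi> x i)))
                     / max 1 (real (card (supp n \<theta>))) \<partial>law n \<theta>)"

definition mult_risk :: "nat \<Rightarrow> vec \<Rightarrow> test \<Rightarrow> real" where
  "mult_risk n \<theta> \<phi> = FDR n \<theta> \<phi> + FNR n \<theta> \<phi>"

definition L_C :: "nat \<Rightarrow> vec \<Rightarrow> (nat \<Rightarrow> bool) \<Rightarrow> real" where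
  "L_C n \<theta> d = (\<Sum>i=1..n. of_bool (\<theta> i = 0) * of_bool (d i)
                          + of_bool (\<theta> i \<noteq> 0) * of_bool (\<not> d i))"

definition classif_risk :: "nat \<Rightarrow> vec \<Rightarrow> test \<Rightarrow> real" where
  "classif_risk n \<theta> \<phi> = (\<integral>x. L_C n \<theta> (\<phi> x) \<partial>law n \<theta>)"

text \<open>The number \<open>\<kappa>\<close> with \<open>sqrt \<kappa> = (sqrt r - \<beta> / sqrt r) / 2\<close>; used for \<open>0 < \<beta> < r\<close> only,
  where the right-hand side is positive.\<close>

definition kappa :: "real \<Rightarrow> real \<Rightarrow> real" where
  "kappa r \<beta> = ((sqrt r - \<beta> / sqrt r) / 2)\<^sup>2"

definition v_R :: "nat \<Rightarrow> real \<Rightarrow> real \<Rightarrow> real" where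
  "v_R n r \<beta> = real n powr (- kappa r \<beta>) / sqrt (ln (real n))"

definition v_C :: "nat \<Rightarrow> real \<Rightarrow> real \<Rightarrow> real" where
  "v_C n r \<beta> = real n powr (1 - \<beta>) * v_R n r \<beta>"

definition plugin_test :: "real \<Rightarrow> (nat \<Rightarrow> vec \<Rightarrow> real) \<Rightarrow> nat \<Rightarrow> test" where
  "plugin_test r \<beta>hat n x i \<longleftrightarrow>
     \<bar>x i\<bar> \<ge> (sqrt r / 2 + \<beta>hat n x / (2 * sqrt r)) * sqrt (2 * ln (real n))"

lemma sqrt_kappa:
  assumes "0 < r" "\<beta> < r"
  shows "sqrt (kappa r \<beta>) = (sqrt r - \<beta> / sqrt r) / 2"
proof -
  have "\<beta> / sqrt r \<le> r / sqrt r"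
    using assms by (intro divide_right_mono) auto
  then show ?thesis
    using assms by (simp add: kappa_def real_div_sqrt)
qed

lemma prob_space_noise: "prob_space (noise n)"
proof -
  interpret product_prob_space "\<lambda>_::nat. density lborel std_normal_density" "{1..n}"
    unfolding product_prob_space_def product_prob_space_axioms_def product_sigma_finite_def
    by (auto intro!: prob_space_normal_density prob_space_imp_sigma_finite)
  show ?thesis unfolding noise_def by (rule prob_space_axioms)
qed

lemma measurable_shift [measurable]:
  "(\<lambda>e. \<lambda>i\<in>{1..n}. \<theta> i + e i) \<in> noise n \<rightarrow>\<^sub>M Rn n"
  unfolding noise_def Rn_def by measurable

lemma prob_space_law: "prob_space (law n \<theta>)"
  unfolding law_def by (intro prob_space.prob_space_distr prob_space_noise measurable_shift)

lemma sets_law [simp, measurable_cong]: "sets (law n \<theta>) = sets (Rn n)"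
  by (simp add: law_def)

lemma plugin_test_measurable:
  assumes "\<beta>hat n \<in> borel_measurable (Rn n)" "i \<in> {1..n}"
  shows "Measurable.pred (Rn n) (\<lambda>x. plugin_test r \<beta>hat n x i)"
proof -
  have "(\<lambda>x. x i) \<in> borel_measurable (Rn n)"
    unfolding Rn_def using assms(2) by measurable
  then show ?thesis
    unfolding plugin_test_def
    using assms(1) unfolding pred_def
    by (intro borel_measurable_le borel_measurable_times borel_measurable_add
        borel_measurable_divide borel_measurable_abs borel_measurable_const)
qed

end

theory Submission
  imports Defs "HOL-Real_Asymp.Real_Asymp"
begin

text \<open>
  The number of coordinates above the level \<open>T = sqrt (2 r log n)\<close> estimates the number \<open>s\<close> of signals
  up to a constant factor: each signal passes \<open>T\<close> with probability at least \<open>1/2\<close>, and the expected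
  number of nulls passing it is at most \<open>n powr (1 - r)\<close>, which is negligible against
  \<open>n powr (1 - \<beta>)\<close> because \<open>\<beta> \<le> r - \<epsilon>\<close>. By Chernoff bounds this fails with probability at most
  \<open>2 exp (- s / 8)\<close>, smaller than any power of \<open>n\<close> because \<open>\<beta> \<le> 1 - \<epsilon>\<close>. Taking logarithms, \<open>\<beta>\<close> is
  estimated with error \<open>O(1 / log n)\<close>, so the plug-in threshold is within \<open>O(1 / sqrt (log n))\<close> of the
  oracle one, a perturbation that changes Gaussian tail probabilities at levels of order
  \<open>sqrt (log n)\<close> only by constant factors.
\<close>

section \<open>Tail bounds for the standard normal law\<close>

abbreviation gauss :: "real measure" where
  "gauss \<equiv> density lborel std_normal_density"

lemma prob_space_gauss: "prob_space gauss"
  using prob_space_normal_density[of 1 0] by simp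

lemma measure_gauss_uminus:
  assumes [measurable]: "A \<in> sets borel"
  shows "measure gauss (uminus -` A) = measure gauss A"
proof -
  have [measurable]: "uminus -` A \<in> sets borel"
    using measurable_sets_borel[of "uminus :: real \<Rightarrow> real" borel A] by simp
  have "emeasure gauss A = (\<integral>\<^sup>+x. ennreal (std_normal_density x) * indicator A x \<partial>lborel)"
    by (simp add: emeasure_density)
  also have "\<dots> = (\<integral>\<^sup>+x. ennreal (std_normal_density x) * indicator (uminus -` A) x \<partial>lborel)"
    by (subst nn_integral_real_affine[where c = "-1" and t = 0])
       (auto simp: normal_density_def indicator_def)
  also have "\<dots> = emeasure gauss (uminus -` A)"
    by (simp add: emeasure_density)
  finally show ?thesis by (simp add: measure_def)
qed

text \<open>The Mills ratio bound. On \<open>{x..}\<close> the factor \<open>t / x\<close> is at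
  least 1, and inserting it under the integral gives an integrand with the explicit antiderivative
  \<open>- std_normal_density t / x\<close>.\<close>

lemma measure_gauss_atLeast_le:
  assumes "0 < x"
  shows "measure gauss {x..} \<le> std_normal_density x / x"
proof -
  have D: "((\<lambda>t. - std_normal_density t / x) has_real_derivative t / x * std_normal_density t) (at t)" for t
    using assms by (auto simp: normal_density_def field_simps intro!: derivative_eq_intros)
  have lim: "((\<lambda>t. - std_normal_density t / x) \<longlongrightarrow> 0) at_top"
    unfolding normal_density_def using assms by real_asymp
  have "emeasure gauss {x..} = (\<integral>\<^sup>+t. ennreal (std_normal_density t) * indicator {x..} t \<partial>lborel)"
    by (simp add: emeasure_density)
  also have "\<dots> \<le> (\<integral>\<^sup>+t. ennreal (t / x * std_normal_density t) * indicator {x..} t \<partial>lborel)"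
  proof (intro nn_integral_mono)
    fix t
    have "1 * std_normal_density t \<le> t / x * std_normal_density t" if "x \<le> t"
      using that assms by (intro mult_right_mono) auto
    then show "ennreal (std_normal_density t) * indicator {x..} t
        \<le> ennreal (t / x * std_normal_density t) * indicator {x..} t"
      by (auto simp: indicator_def intro!: ennreal_leI)
  qed
  also have "\<dots> = ennreal (0 - (- std_normal_density x / x))"
    using assms by (intro nn_integral_FTC_atLeast D lim) auto
  finally show ?thesis
    using assms unfolding measure_def by (intro enn2real_leI) auto
qed

lemma measure_gauss_abs_ge_le:
  assumes "0 < x"
  shows "measure gauss {t. x \<le> \<bar>t\<bar>} \<le> 2 * std_normal_density x / x"
proof -
  interpret prob_space gauss by (rule prob_space_gauss)
  have "{t. x \<le> \<bar>t\<bar>} = {x..} \<union> uminus -` {x..}" by auto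
  then have "prob {t. x \<le> \<bar>t\<bar>} \<le> prob {x..} + prob (uminus -` {x..})"
    using measurable_sets_borel[of "uminus :: real \<Rightarrow> real" borel "{x..}"]
    by (auto intro!: measure_Un_le)
  also have "\<dots> \<le> 2 * std_normal_density x / x"
    using measure_gauss_atLeast_le[OF assms] by (simp add: measure_gauss_uminus)
  finally show ?thesis .
qed

text \<open>Noise with the same sign as \<open>m\<close> pushes \<open>m + t\<close> away from 0,
  and by symmetry this sign has probability at least 1/2.\<close>

lemma measure_gauss_shifted_abs_ge:
  assumes "T \<le> \<bar>m\<bar>"
  shows "1 / 2 \<le> measure gauss {t. T \<le> \<bar>m + t\<bar>}"
proof -
  interpret prob_space gauss by (rule prob_space_gauss)
  have half: "1 / 2 \<le> prob {0..}"
  proof -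
    have "{0..} \<union> uminus -` {0..} = (UNIV :: real set)" by auto
    then have "1 = prob ({0..} \<union> uminus -` {0..})"
      using prob_space by simp
    also have "\<dots> \<le> prob {0..} + prob (uminus -` {0..})"
      using measurable_sets_borel[of "uminus :: real \<Rightarrow> real" borel "{0..}"]
      by (auto intro!: measure_Un_le)
    finally show ?thesis by (simp add: measure_gauss_uminus)
  qed
  show ?thesis
  proof (cases "0 \<le> m")
    case True
    have "prob {0..} \<le> prob {t. T \<le> \<bar>m + t\<bar>}"
      using True assms by (intro finite_measure_mono) auto
    then show ?thesis using half by simp
  next
    case False
    have "prob (uminus -` {0..}) \<le> prob {t. T \<le> \<bar>m + t\<bar>}"
      using False assms by (intro finite_measure_mono) auto
    then show ?thesis using half by (simp add: measure_gauss_uminus)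
  qed
qed

section \<open>Coordinates of the observation and Chernoff bounds for counts\<close>

lemma measurable_coordinate_Rn:
  assumes "i \<in> {1..n}"
  shows "(\<lambda>x. x i) \<in> borel_measurable (Rn n)"
  using assms unfolding Rn_def by measurable

text \<open>The centred coordinate is the noise itself. Events are phrased through
  \<open>x i - \<theta> i\<close> from here on, so that nulls and signals are treated alike.\<close>

lemma measure_law_coordinate:
  assumes i: "i \<in> {1..n}" and A: "A \<in> sets borel"
  shows "measure (law n \<theta>) {x \<in> space (law n \<theta>). x i - \<theta> i \<in> A} = measure gauss A"
proof -
  have eq: "distr (noise n) gauss (\<lambda>e. e i) = gauss"
    unfolding noise_def using i by (intro distr_PiM_component prob_space_gauss)
  have ei: "(\<lambda>e. e i) \<in> noise n \<rightarrow>\<^sub>M gauss"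
    unfolding noise_def using i by (rule measurable_component_singleton)
  have Rn: "{x \<in> space (Rn n). x i - \<theta> i \<in> A} \<in> sets (Rn n)"
    using measurable_coordinate_Rn[OF i] A by measurable
  have shift: "(\<lambda>i\<in>{1..n}. \<theta> i + e i) \<in> space (Rn n)" for e
    by (auto simp: Rn_def space_PiM)
  have "measure (law n \<theta>) {x \<in> space (law n \<theta>). x i - \<theta> i \<in> A}
      = measure (noise n) ((\<lambda>e. \<lambda>i\<in>{1..n}. \<theta> i + e i) -` {x \<in> space (Rn n). x i - \<theta> i \<in> A} \<inter> space (noise n))"
    unfolding law_def space_distr by (rule measure_distr[OF measurable_shift Rn])
  also have "\<dots> = measure (noise n) ((\<lambda>e. e i) -` A \<inter> space (noise n))"
    using i shift by (intro arg_cong[where f = "measure (noise n)"]) auto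
  also have "\<dots> = measure (distr (noise n) gauss (\<lambda>e. e i)) A"
    using ei A by (subst measure_distr) auto
  finally show ?thesis unfolding eq .
qed

text \<open>Independence factors the moment generating function into Bernoulli terms
  \<open>1 + (exp t - 1) * p\<close>, and \<open>1 + y \<le> exp y\<close> replaces each by its
  Poisson counterpart. Only the expected count then survives in the bound.\<close>

lemma exp_count_law_le:
  assumes A [measurable]: "\<And>i. i \<in> {1..n} \<Longrightarrow> A i \<in> sets borel"
  shows "(\<integral>x. exp (t * (\<Sum>i=1..n. indicator (A i) (x i - \<theta> i))) \<partial>law n \<theta>)
      \<le> exp ((exp t - 1) * (\<Sum>i=1..n. measure gauss (A i)))"
proof -
  interpret gauss: prob_space gauss by (rule prob_space_gauss)
  interpret product_sigma_finite "\<lambda>_::nat. gauss"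
    by (simp add: product_sigma_finite_def gauss.sigma_finite_measure_axioms)
  have meas: "(\<lambda>x. exp (t * (\<Sum>i=1..n. indicator (A i) (x i - \<theta> i) :: real))) \<in> borel_measurable (Rn n)"
  proof -
    have "(\<lambda>x. indicator (A i) (x i - \<theta> i) :: real) \<in> borel_measurable (Rn n)" if i: "i \<in> {1..n}" for i
      using A[OF i] measurable_coordinate_Rn[OF i] by measurable
    then show ?thesis by measurable
  qed
  have ind: "exp (t * indicator (A i) y) = 1 + (exp t - 1) * indicator (A i) y" for i and y :: real
    by (simp add: indicator_def)
  have int: "integrable gauss (indicator (A i) :: real \<Rightarrow> real)" if "i \<in> {1..n}" for i
    using A[OF that] by (intro integrable_real_indicator) (auto simp: less_top[symmetric])
  have "(\<integral>x. exp (t * (\<Sum>i=1..n. indicator (A i) (x i - \<theta> i))) \<partial>law n \<theta>)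
      = (\<integral>e. (\<Prod>i=1..n. exp (t * indicator (A i) (e i))) \<partial>noise n)"
    unfolding law_def integral_distr[OF measurable_shift meas]
    by (intro Bochner_Integration.integral_cong refl) (simp add: sum_distrib_left exp_sum[symmetric])
  also have "\<dots> = (\<Prod>i=1..n. \<integral>y. exp (t * indicator (A i) y) \<partial>gauss)"
    unfolding noise_def ind using int
    by (intro product_integral_prod) auto
  also have "\<dots> = (\<Prod>i=1..n. 1 + (exp t - 1) * measure gauss (A i))"
    unfolding ind using int gauss.prob_space by (intro prod.cong refl) simp
  also have "\<dots> \<le> (\<Prod>i=1..n. exp ((exp t - 1) * measure gauss (A i)))"
  proof (intro prod_mono conjI exp_ge_add_one_self)
    fix i
    have "0 \<le> (1 - measure gauss (A i)) + exp t * measure gauss (A i)"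
      by (intro add_nonneg_nonneg) auto
    then show "0 \<le> 1 + (exp t - 1) * measure gauss (A i)"
      by (simp add: algebra_simps)
  qed
  also have "\<dots> = exp ((exp t - 1) * (\<Sum>i=1..n. measure gauss (A i)))"
    by (simp add: sum_distrib_left exp_sum)
  finally show ?thesis .
qed

text \<open>Exponential Markov inequality. The level \<open>c\<close> bounds \<open>t\<close> times
  the count, so a positive \<open>t\<close> gives upper tails and a negative \<open>t\<close> gives
  lower tails.\<close>

lemma chernoff_count_law:
  assumes A: "\<And>i. i \<in> {1..n} \<Longrightarrow> A i \<in> sets borel"
  shows "measure (law n \<theta>) {x \<in> space (law n \<theta>). c \<le> t * (\<Sum>i=1..n. indicator (A i) (x i - \<theta> i))}
      \<le> exp ((exp t - 1) * (\<Sum>i=1..n. measure gauss (A i)) - c)"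
proof -
  interpret prob_space "law n \<theta>" by (rule prob_space_law)
  define F where "F x = (\<Sum>i=1..n. indicator (A i) (x i - \<theta> i) :: real)" for x :: vec
  have meas [measurable]: "F \<in> borel_measurable (law n \<theta>)"
  proof -
    have "(\<lambda>x. indicator (A i) (x i - \<theta> i) :: real) \<in> borel_measurable (Rn n)" if i: "i \<in> {1..n}" for i
      using A[OF i] measurable_coordinate_Rn[OF i] by measurable
    then show ?thesis unfolding F_def by measurable
  qed
  have bd: "\<bar>F x\<bar> \<le> n" for x
  proof -
    have "\<bar>F x\<bar> \<le> (\<Sum>i=1..n. \<bar>indicator (A i) (x i - \<theta> i) :: real\<bar>)" unfolding F_def by (rule sum_abs)
    also have "\<dots> \<le> (\<Sum>i=1..n. 1)" by (intro sum_mono) (auto simp: indicator_def)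
    finally show ?thesis by simp
  qed
  have int: "integrable (law n \<theta>) (\<lambda>x. exp (t * F x))"
  proof (rule integrable_const_bound[where B = "exp (\<bar>t\<bar> * n)"])
    have "t * F x \<le> \<bar>t\<bar> * n" for x
      using abs_le_D1[OF order_refl, of "t * F x"] mult_left_mono[OF bd, of "\<bar>t\<bar>" x]
      by (simp add: abs_mult)
    then show "AE x in law n \<theta>. norm (exp (t * F x)) \<le> exp (\<bar>t\<bar> * n)" by simp
  qed measurable
  have "prob {x \<in> space (law n \<theta>). c \<le> t * F x} = prob {x \<in> space (law n \<theta>). exp c \<le> exp (t * F x)}"
    by simp
  also have "\<dots> \<le> (\<integral>x. exp (t * F x) \<partial>law n \<theta>) / exp c"
    using int by (intro integral_Markov_inequality_measure[where A = "{}"]) auto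
  also have "\<dots> \<le> exp ((exp t - 1) * (\<Sum>i=1..n. measure gauss (A i))) / exp c"
    unfolding F_def using exp_count_law_le[OF A] by (intro divide_right_mono) auto
  finally show ?thesis by (simp add: F_def exp_diff)
qed

section \<open>The sparsity estimator and the concentration of the exceedance count\<close>

definition exceedances :: "real \<Rightarrow> nat \<Rightarrow> vec \<Rightarrow> real" where
  "exceedances r n x = (\<Sum>i=1..n. of_bool (sqrt (2 * r * ln (real n)) \<le> \<bar>x i\<bar>))"

text \<open>Since \<open>ln 0 = 0\<close>, the estimator takes the value 1 when no coordinate exceeds the level.\<close>

definition sparsity_estimator :: "real \<Rightarrow> nat \<Rightarrow> vec \<Rightarrow> real" where
  "sparsity_estimator r n x = 1 - ln (exceedances r n x) / ln (real n)"

lemma borel_measurable_exceedances [measurable]: "exceedances r n \<in> borel_measurable (Rn n)"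
proof -
  have "(\<lambda>x. of_bool (sqrt (2 * r * ln (real n)) \<le> \<bar>x i\<bar>) :: real) \<in> borel_measurable (Rn n)"
    if i: "i \<in> {1..n}" for i
    using measurable_coordinate_Rn[OF i] by measurable
  then show ?thesis unfolding exceedances_def by measurable
qed

lemma borel_measurable_sparsity_estimator: "sparsity_estimator r n \<in> borel_measurable (Rn n)"
  unfolding sparsity_estimator_def by measurable

text \<open>The count lies between \<open>a / 8\<close> and \<open>2 * b\<close> times
  \<open>n powr (1 - \<beta>)\<close>. The logarithm makes these factors additive constants, which
  the division by \<open>ln n\<close> turns into an error of order \<open>1 / ln n\<close>.\<close>

lemma sparsity_estimator_error:
  assumes n: "1 < n" and ab: "0 < a" "0 < b"
    and s: "a * real n powr (1 - \<beta>) \<le> s" "s \<le> b * real n powr (1 - \<beta>)"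
    and E: "s / 8 \<le> exceedances r n x" "exceedances r n x \<le> 2 * s"
  shows "\<bar>sparsity_estimator r n x - \<beta>\<bar> \<le> (\<bar>ln (a / 8)\<bar> + \<bar>ln (2 * b)\<bar>) / ln (real n)"
proof -
  define N where "N = real n powr (1 - \<beta>)"
  have N: "0 < N" "ln N = (1 - \<beta>) * ln (real n)"
    using n by (auto simp: N_def ln_powr)
  have L: "0 < ln (real n)" using n by simp
  have lo: "a / 8 * N \<le> exceedances r n x" and hi: "exceedances r n x \<le> 2 * b * N"
    using s E by (auto simp: N_def)
  have pos: "0 < a / 8 * N" using ab N by simp
  have "ln (a / 8) + ln N = ln (a / 8 * N)" "ln (2 * b) + ln N = ln (2 * b * N)"
    using ab N by (simp_all only: ln_mult_pos)
  moreover have "ln (a / 8 * N) \<le> ln (exceedances r n x)" "ln (exceedances r n x) \<le> ln (2 * b * N)"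
    using lo hi pos by (auto intro!: ln_mono simp del: ln_le_cancel_iff)
  ultimately have "ln (a / 8) + ln N \<le> ln (exceedances r n x)"
    "ln (exceedances r n x) \<le> ln (2 * b) + ln N"
    by simp_all
  then have "\<bar>ln (exceedances r n x) - ln N\<bar> \<le> \<bar>ln (a / 8)\<bar> + \<bar>ln (2 * b)\<bar>"
    by linarith
  then have "\<bar>ln (exceedances r n x) - ln N\<bar> / ln (real n) \<le> (\<bar>ln (a / 8)\<bar> + \<bar>ln (2 * b)\<bar>) / ln (real n)"
    using L by (intro divide_right_mono) auto
  moreover have "sparsity_estimator r n x - \<beta> = - ((ln (exceedances r n x) - ln N) / ln (real n))"
    using L by (simp add: sparsity_estimator_def N field_simps)
  ultimately show ?thesis using L by (simp add: abs_divide)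
qed

lemma card_supp_eq_sum: "real (card (supp n \<theta>)) = (\<Sum>i=1..n. of_bool (\<theta> i \<noteq> 0))"
  by (simp add: supp_def sum.If_cases of_bool_def Int_def)

text \<open>The count splits into null exceedances, of mean at most \<open>s / 4\<close>, and signal
  exceedances, of mean at least \<open>s / 2\<close>. A Chernoff bound is applied to each
  part.\<close>

lemma exceedances_concentration:
  fixes n \<theta> r
  defines "s \<equiv> real (card (supp n \<theta>))" and "T \<equiv> sqrt (2 * r * ln (real n))"
  assumes T: "1 \<le> T" and signal: "\<And>i. i \<in> supp n \<theta> \<Longrightarrow> T \<le> \<bar>\<theta> i\<bar>"
    and s: "real n powr (1 - r) \<le> s / 4" and n: "0 < n"
  shows "measure (law n \<theta>) {x \<in> space (law n \<theta>). \<not> (s / 8 \<le> exceedances r n x \<and> exceedances r n x \<le> 2 * s)}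
      \<le> 2 * exp (- s / 8)"
proof -
  interpret prob_space "law n \<theta>" by (rule prob_space_law)
  \<comment> \<open>Using the empty set at coordinates of the other kind lets both counts run over
    all of \<open>{1..n}\<close>, as the Chernoff lemma requires.\<close>
  define A where "A i = (if \<theta> i = 0 then {t. T \<le> \<bar>t\<bar>} else {})" for i
  define B where "B i = (if \<theta> i \<noteq> 0 then {t. T \<le> \<bar>\<theta> i + t\<bar>} else {})" for i
  have [measurable]: "A i \<in> sets borel" "B i \<in> sets borel" for i
    by (auto simp: A_def B_def)
  define FP where "FP x = (\<Sum>i=1..n. indicator (A i) (x i - \<theta> i) :: real)" for x :: vec
  define TP where "TP x = (\<Sum>i=1..n. indicator (B i) (x i - \<theta> i) :: real)" for x :: vec
  have meas [measurable]: "FP \<in> borel_measurable (Rn n)" "TP \<in> borel_measurable (Rn n)"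
  proof -
    have "(\<lambda>x. indicator (A i) (x i - \<theta> i) :: real) \<in> borel_measurable (Rn n)"
      "(\<lambda>x. indicator (B i) (x i - \<theta> i) :: real) \<in> borel_measurable (Rn n)" if i: "i \<in> {1..n}" for i
      using measurable_coordinate_Rn[OF i] by measurable
    then show "FP \<in> borel_measurable (Rn n)" "TP \<in> borel_measurable (Rn n)"
      unfolding FP_def TP_def by measurable
  qed
  have exc: "exceedances r n x = FP x + TP x" for x
    unfolding exceedances_def FP_def TP_def sum.distrib[symmetric]
    by (intro sum.cong refl) (auto simp: A_def B_def T_def)
  have FP0: "0 \<le> FP x" for x by (auto simp: FP_def intro!: sum_nonneg)
  have TPs: "TP x \<le> s" for x
    unfolding TP_def s_def card_supp_eq_sum by (intro sum_mono) (auto simp: B_def)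
  \<comment> \<open>The level is chosen so that \<open>exp (- T^2 / 2)\<close> is
    \<open>n powr (- r)\<close>; the remaining factor \<open>2 / (T * sqrt (2 * pi))\<close> is at
    most 1 because \<open>T \<ge> 1\<close>.\<close>
  have tail: "measure gauss {t. T \<le> \<bar>t\<bar>} \<le> real n powr (- r)"
  proof -
    have "2 \<le> sqrt (2 * pi)" using pi_gt3 by (intro real_le_rsqrt) simp
    then have "2 \<le> T * sqrt (2 * pi)" using mult_mono[of 1 T 2 "sqrt (2 * pi)"] T by simp
    moreover have "T\<^sup>2 / 2 = r * ln (real n)"
      using T by (auto simp: T_def real_sqrt_ge_1_iff intro!: real_sqrt_pow2)
    ultimately have "2 * std_normal_density T / T \<le> real n powr (- r)"
      using T n by (simp add: normal_density_def powr_def field_simps)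
    then show ?thesis using measure_gauss_abs_ge_le[of T] T by simp
  qed
  have sumA: "(\<Sum>i=1..n. measure gauss (A i)) \<le> s / 4"
  proof -
    have "(\<Sum>i=1..n. measure gauss (A i)) \<le> (\<Sum>i=1..n. real n powr (- r))"
      using tail by (intro sum_mono) (simp add: A_def)
    also have "\<dots> = real n powr (1 - r)"
      using n by (simp add: powr_diff powr_minus field_simps)
    finally show ?thesis using s by simp
  qed
  have sumB: "s / 2 \<le> (\<Sum>i=1..n. measure gauss (B i))"
  proof -
    have "s / 2 = (\<Sum>i=1..n. of_bool (\<theta> i \<noteq> 0) / 2)"
      unfolding s_def card_supp_eq_sum sum_divide_distrib ..
    also have "\<dots> \<le> (\<Sum>i=1..n. measure gauss (B i))"
      using measure_gauss_shifted_abs_ge signal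
      by (intro sum_mono) (auto simp: B_def supp_def)
    finally show ?thesis .
  qed
  have s0: "0 \<le> s" by (simp add: s_def)
  \<comment> \<open>Since \<open>TP \<le> s\<close>, a count above \<open>2 * s\<close> forces
    \<open>FP\<close> above \<open>s\<close>; since \<open>FP \<ge> 0\<close>, a count below
    \<open>s / 8\<close> forces \<open>TP\<close> below \<open>s / 8\<close>.\<close>
  have "{x \<in> space (law n \<theta>). \<not> (s / 8 \<le> exceedances r n x \<and> exceedances r n x \<le> 2 * s)}
     \<subseteq> {x \<in> space (law n \<theta>). s \<le> 1 * FP x} \<union> {x \<in> space (law n \<theta>). - s / 8 \<le> (- 1) * TP x}"
  proof
    fix x assume "x \<in> {x \<in> space (law n \<theta>). \<not> (s / 8 \<le> exceedances r n x \<and> exceedances r n x \<le> 2 * s)}"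
    then show "x \<in> {x \<in> space (law n \<theta>). s \<le> 1 * FP x} \<union> {x \<in> space (law n \<theta>). - s / 8 \<le> (- 1) * TP x}"
      using FP0[of x] TPs[of x] by (auto simp: exc)
  qed
  then have "prob {x \<in> space (law n \<theta>). \<not> (s / 8 \<le> exceedances r n x \<and> exceedances r n x \<le> 2 * s)}
     \<le> prob ({x \<in> space (law n \<theta>). s \<le> 1 * FP x} \<union> {x \<in> space (law n \<theta>). - s / 8 \<le> (- 1) * TP x})"
    by (intro finite_measure_mono) measurable
  also have "\<dots> \<le> prob {x \<in> space (law n \<theta>). s \<le> 1 * FP x} + prob {x \<in> space (law n \<theta>). - s / 8 \<le> (- 1) * TP x}"
    by (intro measure_Un_le) measurable
  \<comment> \<open>With \<open>t = 1\<close> and \<open>exp 1 - 1 \<le> 2\<close> the exponent is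
    at most \<open>s / 2 - s\<close>.\<close>
  also have "prob {x \<in> space (law n \<theta>). s \<le> 1 * FP x} \<le> exp (- s / 8)"
  proof -
    have "prob {x \<in> space (law n \<theta>). s \<le> 1 * FP x}
        \<le> exp ((exp 1 - 1) * (\<Sum>i=1..n. measure gauss (A i)) - s)"
      unfolding FP_def by (rule chernoff_count_law) simp
    also have "\<dots> \<le> exp (- s / 8)"
    proof -
      have "(exp 1 - 1) * (\<Sum>i=1..n. measure gauss (A i)) \<le> 2 * (s / 4)"
        using sumA exp_le by (intro mult_mono) (auto intro: sum_nonneg)
      then show ?thesis using s0 by simp
    qed
    finally show ?thesis .
  qed
  \<comment> \<open>With \<open>t = -1\<close> and \<open>1 - exp (-1) \<ge> 1 / 2\<close> the
    exponent is at most \<open>- s / 4 + s / 8\<close>.\<close>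
  also have "prob {x \<in> space (law n \<theta>). - s / 8 \<le> (- 1) * TP x} \<le> exp (- s / 8)"
  proof -
    have "prob {x \<in> space (law n \<theta>). - s / 8 \<le> (- 1) * TP x}
        \<le> exp ((exp (- 1) - 1) * (\<Sum>i=1..n. measure gauss (B i)) - (- s / 8))"
      unfolding TP_def by (rule chernoff_count_law) simp
    also have "\<dots> \<le> exp (- s / 8)"
    proof -
      have "2 \<le> exp (1 :: real)" using exp_ge_add_one_self[of "1 :: real"] by simp
      then have "exp (- 1) \<le> (1 / 2 :: real)" by (simp add: exp_minus field_simps)
      then have "1 / 2 * (s / 2) \<le> (1 - exp (- 1)) * (\<Sum>i=1..n. measure gauss (B i))"
        using sumB s0 by (intro mult_mono) auto
      then show ?thesis by (simp add: algebra_simps)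
    qed
    finally show ?thesis .
  qed
  finally show ?thesis by simp
qed

section \<open>Tails at perturbed levels and the risk of the plug-in test\<close>

text \<open>In the square of \<open>u * sqrt (2 * L) - h / sqrt (2 * L)\<close> the cross term is
  \<open>- 2 * u * h\<close>, free of \<open>L\<close>. Lowering the level thus costs only a
  constant factor, uniformly for \<open>u\<close> in \<open>[u0, u1]\<close>.\<close>

lemma perturbed_gauss_tail:
  assumes u: "0 < u0" "u0 \<le> u" "u \<le> u1" and h: "0 \<le> h" and L: "0 < L" "h / u0 \<le> L"
  shows "measure gauss {t. u * sqrt (2 * L) - h / sqrt (2 * L) \<le> \<bar>t\<bar>}
      \<le> 2 * exp (u1 * h) / u0 * (exp (- L * u\<^sup>2) / sqrt L)"
    and "0 < u * sqrt (2 * L) - h / sqrt (2 * L)"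
proof -
  define x where "x = u * sqrt (2 * L) - h / sqrt (2 * L)"
  define R where "R = sqrt (2 * L)"
  have R: "0 < R" "R\<^sup>2 = 2 * L" using L by (auto simp: R_def)
  have xR: "x = u * R - h / R" by (simp add: x_def R_def)
  \<comment> \<open>As \<open>R^2 = 2 * L\<close>, the condition \<open>h / u0 \<le> L\<close> says
    that the correction \<open>h / R\<close> is at most half of \<open>u0 * R\<close>.\<close>
  have x_ge: "u0 / 2 * R \<le> x"
  proof -
    have "h \<le> u0 * L" using L u by (simp add: field_simps)
    then have "h \<le> u0 / 2 * R * R" using R(2) by (simp add: power2_eq_square mult.assoc)
    then have "h / R \<le> u0 / 2 * R" using R(1) by (simp add: pos_divide_le_eq)
    moreover have "u0 * R \<le> u * R" using R u by simp
    ultimately show ?thesis by (simp add: xR)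
  qed
  have x0: "0 < u0 / 2 * R" using u R by simp
  then show "0 < u * sqrt (2 * L) - h / sqrt (2 * L)" using x_ge unfolding x_def by simp
  have sq: "x\<^sup>2 \<ge> 2 * L * u\<^sup>2 - 2 * (u1 * h)"
  proof -
    have "x\<^sup>2 = R\<^sup>2 * u\<^sup>2 - 2 * (u * h) + (h / R)\<^sup>2"
      using R(1) by (simp add: xR power2_eq_square field_simps)
    moreover have "u * h \<le> u1 * h" using u h by (intro mult_right_mono) auto
    ultimately show ?thesis using zero_le_power2[of "h / R"] unfolding R(2) by linarith
  qed
  have dens: "std_normal_density x \<le> exp (u1 * h) * exp (- L * u\<^sup>2) / sqrt (2 * pi)"
  proof -
    have "exp (- (x\<^sup>2 / 2)) \<le> exp (u1 * h + - L * u\<^sup>2)"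
      using sq by simp
    then show ?thesis
      unfolding exp_add by (simp add: normal_density_def divide_right_mono)
  qed
  have "measure gauss {t. x \<le> \<bar>t\<bar>} \<le> 2 * std_normal_density x / x"
    using x_ge x0 by (intro measure_gauss_abs_ge_le) simp
  also have "\<dots> \<le> 2 * (exp (u1 * h) * exp (- L * u\<^sup>2) / sqrt (2 * pi)) / (u0 / 2 * R)"
    using dens x_ge x0 by (intro frac_le mult_left_mono) auto
  also have "\<dots> = 2 / sqrt pi * (exp (u1 * h) / u0 * (exp (- L * u\<^sup>2) / sqrt L))"
    using L u by (simp add: R_def real_sqrt_mult field_simps)
  also have "\<dots> \<le> 2 * (exp (u1 * h) / u0 * (exp (- L * u\<^sup>2) / sqrt L))"
    using u L pi_gt3 by (intro mult_right_mono) (auto simp: field_simps)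
  finally show "measure gauss {t. u * sqrt (2 * L) - h / sqrt (2 * L) \<le> \<bar>t\<bar>}
      \<le> 2 * exp (u1 * h) / u0 * (exp (- L * u\<^sup>2) / sqrt L)"
    by (simp add: x_def)
qed

lemma integral_count_law:
  assumes A: "\<And>i. i \<in> {1..n} \<Longrightarrow> A i \<in> sets borel"
  shows "integrable (law n \<theta>) (\<lambda>x. \<Sum>i=1..n. indicator (A i) (x i - \<theta> i) :: real)"
    and "(\<integral>x. (\<Sum>i=1..n. indicator (A i) (x i - \<theta> i)) \<partial>law n \<theta>) = (\<Sum>i=1..n. measure gauss (A i))"
proof -
  interpret prob_space "law n \<theta>" by (rule prob_space_law)
  have sets: "{x \<in> space (law n \<theta>). x i - \<theta> i \<in> A i} \<in> sets (law n \<theta>)" if i: "i \<in> {1..n}" for i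
    using measurable_coordinate_Rn[OF i] A[OF i] by measurable
  have ind: "indicator (A i) (x i - \<theta> i) = (indicator {x \<in> space (law n \<theta>). x i - \<theta> i \<in> A i} x :: real)"
    if "x \<in> space (law n \<theta>)" for i x
    using that by (simp add: indicator_def)
  have int: "integrable (law n \<theta>) (\<lambda>x. indicator (A i) (x i - \<theta> i) :: real)" if i: "i \<in> {1..n}" for i
    using sets[OF i]
    by (subst Bochner_Integration.integrable_cong[OF refl ind])
       (auto intro!: integrable_real_indicator simp: less_top[symmetric])
  show "integrable (law n \<theta>) (\<lambda>x. \<Sum>i=1..n. indicator (A i) (x i - \<theta> i) :: real)"
    using int by (intro Bochner_Integration.integrable_sum) auto
  have "(\<integral>x. indicator (A i) (x i - \<theta> i) \<partial>law n \<theta>) = measure gauss (A i)" if i: "i \<in> {1..n}" for i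
    using sets[OF i] measure_law_coordinate[OF i A[OF i]]
    by (subst Bochner_Integration.integral_cong[OF refl ind]) (auto simp: Int_absorb1)
  then show "(\<integral>x. (\<Sum>i=1..n. indicator (A i) (x i - \<theta> i)) \<partial>law n \<theta>) = (\<Sum>i=1..n. measure gauss (A i))"
    using int by (subst Bochner_Integration.integral_sum) auto
qed

text \<open>An error \<open>K / L\<close> in \<open>bh\<close> moves the threshold by at most
  \<open>K / L / (2 * sqrt r) * sqrt (2 * L)\<close>, which is \<open>w\<close>. The upper bound is
  written as the signal level minus a margin, the amount of noise needed to miss a signal.\<close>

lemma plugin_threshold_between:
  fixes r n \<beta> K bh
  defines "L \<equiv> ln (real n)"
  defines "w \<equiv> K / sqrt r / sqrt (2 * L)" and "t \<equiv> (sqrt r / 2 + bh / (2 * sqrt r)) * sqrt (2 * L)"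
  assumes r: "0 < r" and n: "1 < n" and bh: "\<bar>bh - \<beta>\<bar> \<le> K / L"
  shows "(sqrt r / 2 + \<beta> / (2 * sqrt r)) * sqrt (2 * L) - w \<le> t"
    and "t \<le> sqrt (2 * r * L) - ((sqrt r / 2 - \<beta> / (2 * sqrt r)) * sqrt (2 * L) - w)"
proof -
  define R where "R = sqrt (2 * L)"
  have R: "0 < R" "L = R * R / 2" using n by (auto simp: R_def L_def)
  define q where "q = sqrt r"
  have q: "0 < q" using r by (simp add: q_def)
  have "\<bar>(bh - \<beta>) / (2 * q) * R\<bar> = \<bar>bh - \<beta>\<bar> / (2 * q) * R"
    using q R by (simp add: abs_mult)
  also have "\<dots> \<le> K / L / (2 * q) * R"
    using bh q R(1) by (intro mult_right_mono divide_right_mono) auto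
  also have "\<dots> = w"
    using q R(1) unfolding w_def R_def[symmetric] q_def[symmetric] R(2) by (simp add: field_simps)
  finally have "\<bar>(bh - \<beta>) / (2 * q) * R\<bar> \<le> w" .
  moreover have "t - (q / 2 + \<beta> / (2 * q)) * R = (bh - \<beta>) / (2 * q) * R"
    unfolding t_def R_def[symmetric] q_def[symmetric] by (simp add: ring_distribs diff_divide_distrib)
  moreover have "sqrt (2 * r * L) - (q / 2 - \<beta> / (2 * q)) * R - (q / 2 + \<beta> / (2 * q)) * R = 0"
    by (simp add: R_def q_def real_sqrt_mult[symmetric] algebra_simps)
  ultimately show "(sqrt r / 2 + \<beta> / (2 * sqrt r)) * sqrt (2 * L) - w \<le> t"
    "t \<le> sqrt (2 * r * L) - ((sqrt r / 2 - \<beta> / (2 * sqrt r)) * sqrt (2 * L) - w)"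
    unfolding R_def[symmetric] q_def[symmetric] by linarith+
qed

text \<open>
  On the good event the random threshold lies in \<open>[x1, T - x2]\<close>, so every error of the plug-in test
  forces the noise at that coordinate to exceed a deterministic level: \<open>x1\<close> at a null coordinate,
  \<open>x2\<close> at a signal. Moreover at least \<open>s / 8\<close> coordinates are rejected.
\<close>

lemma plugin_risk_le:
  fixes n r \<beta> K \<theta>
  defines "L \<equiv> ln (real n)" and "s \<equiv> real (card (supp n \<theta>))"
  defines "w \<equiv> K / sqrt r / sqrt (2 * L)"
  defines "x1 \<equiv> (sqrt r / 2 + \<beta> / (2 * sqrt r)) * sqrt (2 * L) - w"
    and "x2 \<equiv> (sqrt r / 2 - \<beta> / (2 * sqrt r)) * sqrt (2 * L) - w"
  defines "good \<equiv> \<lambda>x. s / 8 \<le> exceedances r n x \<and> exceedances r n x \<le> 2 * s"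
  assumes r: "0 < r" and n: "1 < n" and s: "0 < s" and x2: "0 < x2"
    and signal: "\<And>i. i \<in> supp n \<theta> \<Longrightarrow> sqrt (2 * r * L) \<le> \<bar>\<theta> i\<bar>"
    and est: "\<And>x. good x \<Longrightarrow> \<bar>sparsity_estimator r n x - \<beta>\<bar> \<le> K / L"
    and q: "measure gauss {t. x1 \<le> \<bar>t\<bar>} \<le> q1" "measure gauss {t. x2 \<le> \<bar>t\<bar>} \<le> q2"
    and P: "measure (law n \<theta>) {x \<in> space (law n \<theta>). \<not> good x} \<le> P"
  shows "classif_risk n \<theta> (plugin_test r (sparsity_estimator r) n) \<le> n * q1 + s * q2 + n * P"
    and "mult_risk n \<theta> (plugin_test r (sparsity_estimator r) n) \<le> 9 / s * (n * q1 + s * q2) + 2 * P"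
proof -
  interpret prob_space "law n \<theta>" by (rule prob_space_law)
  define \<phi> where "\<phi> = plugin_test r (sparsity_estimator r) n"
  define T where "T = sqrt (2 * r * L)"
  define A where "A i = {t. (if \<theta> i = 0 then x1 else x2) \<le> \<bar>t\<bar>}" for i
  have A [measurable]: "A i \<in> sets borel" for i unfolding A_def by measurable
  define G where "G x = (\<Sum>i=1..n. indicator (A i) (x i - \<theta> i) :: real)" for x :: vec
  have G0: "0 \<le> G x" for x unfolding G_def by (intro sum_nonneg) auto
  have q0: "0 \<le> q1" "0 \<le> q2" and P0: "0 \<le> P"
    using q P measure_nonneg order_trans by blast+
  have EG: "(\<integral>x. G x \<partial>law n \<theta>) \<le> n * q1 + s * q2"
  proof -
    have "(\<integral>x. G x \<partial>law n \<theta>) = (\<Sum>i=1..n. measure gauss (A i))"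
      unfolding G_def by (rule integral_count_law) (rule A)
    also have "\<dots> \<le> (\<Sum>i=1..n. q1 + of_bool (\<theta> i \<noteq> 0) * q2)"
      using q q0 by (intro sum_mono) (auto simp: A_def add_increasing)
    also have "\<dots> = n * q1 + s * q2"
      by (simp only: sum.distrib s_def card_supp_eq_sum sum_distrib_right) simp
    finally show ?thesis .
  qed
  define bad where "bad = {x \<in> space (law n \<theta>). \<not> good x}"
  have bad: "bad \<in> sets (law n \<theta>)" unfolding bad_def good_def by measurable
  \<comment> \<open>All three losses have this shape: at most \<open>c * G\<close> on the good event
    and at most \<open>d\<close> everywhere. The classification loss takes
    \<open>(c, d) = (1, n)\<close>, the FDR takes \<open>(8 / s, 1)\<close> and the FNR takes
    \<open>(1 / s, 1)\<close>.\<close>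
  have integral_le: "(\<integral>x. f x \<partial>law n \<theta>) \<le> c * (n * q1 + s * q2) + d * P"
    if c: "0 \<le> c" and d: "0 \<le> d"
      and f_good: "\<And>x. good x \<Longrightarrow> f x \<le> c * G x" and f_bad: "\<And>x. f x \<le> d" for f c d
  proof -
    have int: "integrable (law n \<theta>) (\<lambda>x. c * G x + d * indicator bad x)"
      unfolding G_def using bad integral_count_law(1)[OF A] by (auto simp: less_top[symmetric])
    have "(\<integral>x. f x \<partial>law n \<theta>) \<le> (\<integral>x. c * G x + d * indicator bad x \<partial>law n \<theta>)"
    \<comment> \<open>An integrable nonnegative majorant suffices here: a non-integrable
      \<open>f\<close> has Bochner integral 0.\<close>
    proof (rule integral_mono'[OF int])
      fix x assume x: "x \<in> space (law n \<theta>)"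
      show "f x \<le> c * G x + d * indicator bad x"
      proof (cases "good x")
        case True
        then show ?thesis using f_good[OF True] d by (simp add: add_increasing2)
      next
        case False
        then have "x \<in> bad" using x by (simp add: bad_def)
        then show ?thesis using f_bad[of x] c G0[of x] by (simp add: add_increasing)
      qed
    qed (use c d G0 in auto)
    also have "\<dots> = c * (\<integral>x. G x \<partial>law n \<theta>) + d * prob bad"
      unfolding G_def using bad integral_count_law(1)[OF A]
      by (subst Bochner_Integration.integral_add) (auto simp: less_top[symmetric])
    also have "\<dots> \<le> c * (n * q1 + s * q2) + d * P"
      using EG P c d unfolding bad_def by (intro add_mono mult_left_mono)
    finally show ?thesis .
  qed
  have thr: "x1 \<le> (sqrt r / 2 + sparsity_estimator r n x / (2 * sqrt r)) * sqrt (2 * L)"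
    "(sqrt r / 2 + sparsity_estimator r n x / (2 * sqrt r)) * sqrt (2 * L) \<le> T - x2" if "good x" for x
    using plugin_threshold_between[OF r n] est[OF that]
    unfolding x1_def x2_def w_def T_def L_def by auto
  have FP: "of_bool (\<theta> i = 0) * of_bool (\<phi> x i) \<le> (indicator (A i) (x i - \<theta> i) :: real)"
    if "good x" for x i
    using thr(1)[OF that] by (auto simp: \<phi>_def plugin_test_def A_def L_def)
  have FN: "of_bool (\<theta> i \<noteq> 0) * (1 - of_bool (\<phi> x i)) \<le> (indicator (A i) (x i - \<theta> i) :: real)"
    if "good x" "i \<in> {1..n}" for x i
  proof -
    have "x2 \<le> \<bar>x i - \<theta> i\<bar>" if "\<theta> i \<noteq> 0" "\<not> \<phi> x i"
    proof -
      have "\<bar>x i\<bar> < T - x2"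
        using thr(2)[OF \<open>good x\<close>] \<open>\<not> \<phi> x i\<close> by (auto simp: \<phi>_def plugin_test_def L_def)
      moreover have "T \<le> \<bar>\<theta> i\<bar>"
        using signal that \<open>i \<in> {1..n}\<close> by (auto simp: T_def supp_def)
      ultimately show ?thesis by linarith
    qed
    then show ?thesis by (auto simp: A_def)
  qed
  \<comment> \<open>The threshold is at most \<open>T - x2 < T\<close>, so each coordinate reaching
    \<open>T\<close> is rejected. This keeps the random denominator of the FDR at least
    \<open>s / 8\<close>.\<close>
  have rejections: "s / 8 \<le> (\<Sum>i=1..n. of_bool (\<phi> x i))" if "good x" for x
  proof -
    have "s / 8 \<le> exceedances r n x" using that by (simp add: good_def)
    also have "\<dots> \<le> (\<Sum>i=1..n. of_bool (\<phi> x i))"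
      unfolding exceedances_def using thr(2)[OF that] x2
      by (intro sum_mono) (auto simp: \<phi>_def plugin_test_def L_def T_def)
    finally show ?thesis .
  qed

  have "classif_risk n \<theta> \<phi> \<le> 1 * (n * q1 + s * q2) + n * P"
    unfolding classif_risk_def
  proof (rule integral_le)
    fix x assume x: "good x"
    show "L_C n \<theta> (\<phi> x) \<le> 1 * G x"
      unfolding L_C_def G_def mult_1
    proof (intro sum_mono)
      fix i assume i: "i \<in> {1..n}"
      show "of_bool (\<theta> i = 0) * of_bool (\<phi> x i) + of_bool (\<theta> i \<noteq> 0) * of_bool (\<not> \<phi> x i)
          \<le> (indicator (A i) (x i - \<theta> i) :: real)"
        using FP[OF x, of i] FN[OF x i] by (cases "\<theta> i = 0"; cases "\<phi> x i") simp_all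
    qed
  next
    fix x
    have "L_C n \<theta> (\<phi> x) \<le> (\<Sum>i=1..n. 1)"
      unfolding L_C_def by (intro sum_mono) auto
    then show "L_C n \<theta> (\<phi> x) \<le> n" by simp
  qed simp_all
  then show "classif_risk n \<theta> (plugin_test r (sparsity_estimator r) n) \<le> n * q1 + s * q2 + n * P"
    by (simp add: \<phi>_def)

  have "FDR n \<theta> \<phi> \<le> 8 / s * (n * q1 + s * q2) + 1 * P"
    unfolding FDR_def
  proof (rule integral_le)
    fix x assume x: "good x"
    have "(\<Sum>i=1..n. of_bool (\<theta> i = 0) * of_bool (\<phi> x i)) \<le> G x"
      unfolding G_def by (intro sum_mono FP x)
    then have "(\<Sum>i=1..n. of_bool (\<theta> i = 0) * of_bool (\<phi> x i)) / max 1 (\<Sum>i=1..n. of_bool (\<phi> x i))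
        \<le> G x / (s / 8)"
      using rejections[OF x] s G0 by (intro frac_le) auto
    then show "(\<Sum>i=1..n. of_bool (\<theta> i = 0) * of_bool (\<phi> x i)) / max 1 (\<Sum>i=1..n. of_bool (\<phi> x i))
        \<le> 8 / s * G x"
      by (simp add: mult.commute)
  next
    fix x
    have "(\<Sum>i=1..n. of_bool (\<theta> i = 0) * of_bool (\<phi> x i)) \<le> (\<Sum>i=1..n. of_bool (\<phi> x i) :: real)"
      by (intro sum_mono) auto
    then show "(\<Sum>i=1..n. of_bool (\<theta> i = 0) * of_bool (\<phi> x i)) / max 1 (\<Sum>i=1..n. of_bool (\<phi> x i)) \<le> (1 :: real)"
      by (subst divide_le_eq_1_pos) auto
  qed (use s in auto)
  moreover have "FNR n \<theta> \<phi> \<le> 1 / s * (n * q1 + s * q2) + 1 * P"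
    unfolding FNR_def s_def[symmetric]
  proof (rule integral_le)
    fix x assume x: "good x"
    have "(\<Sum>i=1..n. of_bool (\<theta> i \<noteq> 0) * (1 - of_bool (\<phi> x i))) \<le> G x"
      unfolding G_def by (intro sum_mono FN x)
    then have "(\<Sum>i=1..n. of_bool (\<theta> i \<noteq> 0) * (1 - of_bool (\<phi> x i))) / max 1 s \<le> G x / s"
      using s G0 by (intro frac_le) auto
    then show "(\<Sum>i=1..n. of_bool (\<theta> i \<noteq> 0) * (1 - of_bool (\<phi> x i))) / max 1 s \<le> 1 / s * G x"
      by simp
  next
    fix x
    have "(\<Sum>i=1..n. of_bool (\<theta> i \<noteq> 0) * (1 - of_bool (\<phi> x i))) \<le> s"
      unfolding s_def card_supp_eq_sum by (intro sum_mono) auto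
    then show "(\<Sum>i=1..n. of_bool (\<theta> i \<noteq> 0) * (1 - of_bool (\<phi> x i))) / max 1 s \<le> 1"
      by (subst divide_le_eq_1_pos) auto
  qed (use s in auto)
  moreover have "8 / s * X + 1 * P + (1 / s * X + 1 * P) = 9 / s * X + 2 * P" for X
    using s by (simp add: field_simps)
  ultimately show "mult_risk n \<theta> (plugin_test r (sparsity_estimator r) n) \<le> 9 / s * (n * q1 + s * q2) + 2 * P"
    unfolding mult_risk_def \<phi>_def[symmetric] by (metis add_mono)
qed

section \<open>Rates uniform in \<beta> and the final bound\<close>

text \<open>The balance behind the oracle threshold: up to logarithms a null passes it with
  probability \<open>n powr (- (kappa r \<beta> + \<beta>))\<close>, so \<open>n\<close> nulls cost
  as much as \<open>n powr (1 - \<beta>)\<close> signals, each missed with probability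
  \<open>n powr (- kappa r \<beta>)\<close>.\<close>

lemma kappa_plus_beta:
  assumes "0 < r"
  shows "kappa r \<beta> + \<beta> = (sqrt r / 2 + \<beta> / (2 * sqrt r))\<^sup>2"
proof -
  have "sqrt r \<noteq> 0" using assms by simp
  then show ?thesis by (simp add: kappa_def power2_eq_square field_simps)
qed

theorem mainTheorem10:
  fixes r a b :: real
  assumes "0 < r" and "0 < a" and "a < b"
  shows "\<exists>\<beta>hat :: nat \<Rightarrow> (nat \<Rightarrow> real) \<Rightarrow> real.
    (\<forall>n. \<beta>hat n \<in> borel_measurable (Rn n)) \<and>
    (\<forall>\<epsilon>>0. \<exists>C>0. \<forall>\<^sub>F n in sequentially. \<forall>\<beta>\<in>{\<epsilon> .. min r 1 - \<epsilon>}.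
       (SUP \<theta>\<in>Theta a b n r \<beta>. ereal (classif_risk n \<theta> (plugin_test r \<beta>hat n)))
          \<le> ereal (C * v_C n r \<beta>) \<and>
       (SUP \<theta>\<in>Theta a b n r \<beta>. ereal (mult_risk n \<theta> (plugin_test r \<beta>hat n)))
          \<le> ereal (C * v_R n r \<beta>))"
proof (intro exI[of _ "sparsity_estimator r"] conjI allI impI borel_measurable_sparsity_estimator)
  fix \<epsilon> :: real assume \<epsilon>: "0 < \<epsilon>"
  have b: "0 < b" using assms by simp
  \<comment> \<open>\<open>K\<close> is the constant of the estimation error, and
    \<open>h / sqrt (2 * L)\<close> is the resulting shift of the threshold. \<open>u0\<close>
    bounds the null and signal levels below for every admissible \<beta>; its second term comes from
    \<open>\<beta> \<le> r - \<epsilon>\<close>.\<close>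
  define K where "K = \<bar>ln (a / 8)\<bar> + \<bar>ln (2 * b)\<bar>"
  define h where "h = K / sqrt r"
  define u0 where "u0 = min (sqrt r / 2) (\<epsilon> / (2 * sqrt r))"
  define D where "D = 2 * exp (sqrt r * h) / u0"
  \<comment> \<open>The summands \<open>D\<close>, \<open>b * D\<close> and 1 pay for nulls, signals
    and the bad event. In \<open>C2\<close> the factor \<open>9 / a\<close> comes from
    \<open>9 / s\<close> and \<open>s \<ge> a * N\<close>, and the 2 counts the bad event once for
    the FDR and once for the FNR.\<close>
  define C1 where "C1 = D + b * D + 1"
  define C2 where "C2 = 9 / a * (D + b * D) + 2"
  have h: "0 \<le> h" using assms by (simp add: h_def K_def)
  have u0: "0 < u0" using assms \<epsilon> by (simp add: u0_def)
  have D: "0 < D" using u0 by (simp add: D_def)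
  have C: "0 < C1" "0 < C2" using D assms b by (auto simp: C1_def C2_def intro!: add_nonneg_pos)
  \<comment> \<open>None of the four asymptotic conditions mentions \<beta> or \<theta>, which makes
    the choice of \<open>n\<close> uniform.\<close>
  have ev1: "\<forall>\<^sub>F n in sequentially. h / u0 \<le> ln (real n)" by real_asymp
  have ev2: "\<forall>\<^sub>F n in sequentially. 1 \<le> sqrt (2 * r * ln (real n))"
    using assms by real_asymp
  have ev3: "\<forall>\<^sub>F n in sequentially. real n powr (- \<epsilon>) \<le> a / 4"
    using assms \<epsilon> by real_asymp
  have ev4: "\<forall>\<^sub>F n in sequentially. 2 * exp (- (a * real n powr \<epsilon>) / 8) \<le> real n powr (- r) / sqrt (ln (real n))"
    using assms \<epsilon> by real_asymp
  show "\<exists>C>0. \<forall>\<^sub>F n in sequentially. \<forall>\<beta>\<in>{\<epsilon> .. min r 1 - \<epsilon>}.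
       (SUP \<theta>\<in>Theta a b n r \<beta>. ereal (classif_risk n \<theta> (plugin_test r (sparsity_estimator r) n)))
          \<le> ereal (C * v_C n r \<beta>) \<and>
       (SUP \<theta>\<in>Theta a b n r \<beta>. ereal (mult_risk n \<theta> (plugin_test r (sparsity_estimator r) n)))
          \<le> ereal (C * v_R n r \<beta>)"
  proof (intro exI[of _ "C1 + C2"] conjI)
    show "\<forall>\<^sub>F n in sequentially. \<forall>\<beta>\<in>{\<epsilon> .. min r 1 - \<epsilon>}.
       (SUP \<theta>\<in>Theta a b n r \<beta>. ereal (classif_risk n \<theta> (plugin_test r (sparsity_estimator r) n)))
          \<le> ereal ((C1 + C2) * v_C n r \<beta>) \<and>
       (SUP \<theta>\<in>Theta a b n r \<beta>. ereal (mult_risk n \<theta> (plugin_test r (sparsity_estimator r) n)))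
          \<le> ereal ((C1 + C2) * v_R n r \<beta>)"
      using ev1 ev2 ev3 ev4 eventually_gt_at_top[of 1]
    proof eventually_elim
      case (elim n)
      define L where "L = ln (real n)"
      have n: "1 < n" and L: "0 < L" using elim by (auto simp: L_def)
      show ?case
      proof (intro ballI)
        fix \<beta> assume "\<beta> \<in> {\<epsilon> .. min r 1 - \<epsilon>}"
        then have \<beta>: "\<epsilon> \<le> \<beta>" "\<beta> \<le> r - \<epsilon>" "\<beta> \<le> 1 - \<epsilon>" by auto
        define u where "u = sqrt r / 2 + \<beta> / (2 * sqrt r)"
        define u' where "u' = sqrt r / 2 - \<beta> / (2 * sqrt r)"
        have q: "0 < sqrt r" "sqrt r * sqrt r = r" using assms by auto
        have "sqrt r / 2 * (2 * sqrt r) = r" using q by simp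
        then have "(\<epsilon> + \<beta>) / (2 * sqrt r) \<le> sqrt r / 2"
          using \<beta> q(1) by (subst pos_divide_le_eq) auto
        then have sum_le: "\<epsilon> / (2 * sqrt r) + \<beta> / (2 * sqrt r) \<le> sqrt r / 2"
          by (simp add: add_divide_distrib)
        have "0 \<le> \<epsilon> / (2 * sqrt r)" "0 \<le> \<beta> / (2 * sqrt r)"
          using \<beta> \<epsilon> q by auto
        then have u: "u0 \<le> u" "u \<le> sqrt r" and u': "u0 \<le> u'" "u' \<le> sqrt r"
          using sum_le q(1) unfolding u_def u'_def u0_def by linarith+
        have u2: "u\<^sup>2 = kappa r \<beta> + \<beta>" "u'\<^sup>2 = kappa r \<beta>"
          using kappa_plus_beta[OF assms(1), of \<beta>] by (simp_all add: u_def u'_def kappa_def diff_divide_distrib mult.commute)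
        \<comment> \<open>This passes from the rate \<open>n powr (- r)\<close> of the bad event,
          free of \<beta>, to the null tail \<open>W\<close>.\<close>
        have ur: "kappa r \<beta> + \<beta> \<le> r"
          using power_mono[OF u(2), of 2] u u0 assms(1) unfolding u2 by simp
        define N where "N = real n powr (1 - \<beta>)"
        have N: "0 < N" "real n powr \<epsilon> \<le> N"
          using n \<beta> by (auto simp: N_def intro!: powr_mono)
        define vR where "vR = v_R n r \<beta>"
        define W where "W = real n powr (- (kappa r \<beta> + \<beta>)) / sqrt L"
        have vR: "0 < vR" using n by (simp add: vR_def v_R_def)
        have W: "0 \<le> W" using L by (simp add: W_def)
        have vC: "v_C n r \<beta> = N * vR" by (simp add: v_C_def N_def vR_def)
        have nW: "real n * W = N * vR"
        proof -
          have "real n * real n powr (- (kappa r \<beta> + \<beta>)) = N * real n powr (- kappa r \<beta>)"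
            using n unfolding N_def powr_add[symmetric] by (simp add: powr_mult_base algebra_simps)
          then show ?thesis by (simp add: W_def vR_def v_R_def L_def)
        qed
        have W_le: "W \<le> vR"
          unfolding W_def vR_def v_R_def L_def using n \<beta> \<epsilon>
          by (intro divide_right_mono powr_mono) auto
        have exps: "exp (- L * u\<^sup>2) / sqrt L = W" "exp (- L * u'\<^sup>2) / sqrt L = vR"
          using n unfolding u2 W_def vR_def v_R_def L_def by (simp_all add: powr_def algebra_simps)
        have hL: "h / u0 \<le> L" using elim by (simp add: L_def)
        note tail = perturbed_gauss_tail[OF u0 u h L hL, unfolded exps, folded D_def]
        note tail' = perturbed_gauss_tail[OF u0 u' h L hL, unfolded exps, folded D_def]
        have *: "classif_risk n \<theta> (plugin_test r (sparsity_estimator r) n) \<le> (C1 + C2) * v_C n r \<beta> \<and>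
            mult_risk n \<theta> (plugin_test r (sparsity_estimator r) n) \<le> (C1 + C2) * v_R n r \<beta>"
          if \<theta>: "\<theta> \<in> Theta a b n r \<beta>" for \<theta>
        proof -
          define s where "s = real (card (supp n \<theta>))"
          have s: "a * N \<le> s" "s \<le> b * N"
            and signal: "\<And>i. i \<in> supp n \<theta> \<Longrightarrow> sqrt (2 * r * ln (real n)) \<le> \<bar>\<theta> i\<bar>"
            using \<theta> by (auto simp: Theta_def s_def N_def)
          have s0: "0 < s" using s(1) N assms(2) mult_pos_pos[of a N] by linarith
          \<comment> \<open>The gap \<open>\<epsilon>\<close> between \<beta> and \<open>r\<close>
            supplies a factor \<open>n powr (- \<epsilon>)\<close>, which absorbs the constant
            \<open>a / 4\<close>.\<close>
          have "real n powr (1 - r) \<le> real n powr (1 - \<beta> + (- \<epsilon>))"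
            using n \<beta> by (intro powr_mono) auto
          also have "\<dots> = N * real n powr (- \<epsilon>)" unfolding N_def by (rule powr_add)
          also have "\<dots> \<le> N * (a / 4)" using N elim by (intro mult_left_mono) auto
          also have "\<dots> \<le> s / 4" using s by (simp add: mult.commute)
          finally have small: "real n powr (1 - r) \<le> s / 4" .
          \<comment> \<open>The bound \<open>\<beta> \<le> 1 - \<epsilon>\<close> makes the number
            of signals grow polynomially, so \<open>exp (- s / 8)\<close> beats every power of
            \<open>n\<close>.\<close>
          have "a * real n powr \<epsilon> \<le> s"
            using s(1) assms(2) mult_left_mono[OF N(2), of a] by linarith
          then have "2 * exp (- s / 8) \<le> 2 * exp (- (a * real n powr \<epsilon>) / 8)" by simp
          also have "\<dots> \<le> real n powr (- r) / sqrt L" using elim by (simp add: L_def)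
          also have "\<dots> \<le> W"
            unfolding W_def using ur n L by (intro divide_right_mono powr_mono) auto
          finally have P: "2 * exp (- s / 8) \<le> W" .
          have prob: "measure (law n \<theta>) {x \<in> space (law n \<theta>).
              \<not> (s / 8 \<le> exceedances r n x \<and> exceedances r n x \<le> 2 * s)} \<le> W"
            unfolding s_def using elim signal small P n
            by (intro order_trans[OF exceedances_concentration]) (auto simp: s_def)
          have est: "\<bar>sparsity_estimator r n x - \<beta>\<bar> \<le> K / L"
            if "s / 8 \<le> exceedances r n x \<and> exceedances r n x \<le> 2 * s" for x
            using sparsity_estimator_error[OF n assms(2) b s[unfolded N_def]] that
            by (simp add: K_def L_def)
          \<comment> \<open>After folding, \<open>x1\<close> and \<open>x2\<close> are the perturbed
            levels for \<open>u\<close> and \<open>u'\<close>; the tail bounds then enter with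
            \<open>q1 = D * W\<close>, \<open>q2 = D * vR\<close> and \<open>P = W\<close>.\<close>
          note risk = plugin_risk_le[OF assms(1) n, where \<theta> = \<theta> and \<beta> = \<beta> and K = K,
              folded s_def h_def L_def, folded u_def u'_def, OF s0 tail'(2)]
          have risks:
            "classif_risk n \<theta> (plugin_test r (sparsity_estimator r) n) \<le> n * (D * W) + s * (D * vR) + n * W"
            "mult_risk n \<theta> (plugin_test r (sparsity_estimator r) n) \<le> 9 / s * (n * (D * W) + s * (D * vR)) + 2 * W"
            by (rule risk; fact signal[folded L_def] est tail(1) tail'(1) prob)+
          have main: "n * (D * W) + s * (D * vR) \<le> (D + b * D) * (N * vR)"
          proof -
            have "s * (D * vR) \<le> b * N * (D * vR)" using s D vR by (intro mult_right_mono) auto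
            moreover have "n * (D * W) = D * (N * vR)"
              unfolding nW[symmetric] by (rule mult.left_commute)
            ultimately show ?thesis by (simp only: distrib_right) (simp add: mult_ac)
          qed
          have "classif_risk n \<theta> (plugin_test r (sparsity_estimator r) n) \<le> C1 * (N * vR)"
            using risks(1) main nW by (simp add: C1_def algebra_simps)
          also have "\<dots> \<le> (C1 + C2) * v_C n r \<beta>"
            unfolding vC using C N vR by (intro mult_right_mono) auto
          finally have 1: "classif_risk n \<theta> (plugin_test r (sparsity_estimator r) n) \<le> (C1 + C2) * v_C n r \<beta>" .
          have "9 / s * (n * (D * W) + s * (D * vR)) \<le> 9 / (a * N) * ((D + b * D) * (N * vR))"
            using main s s0 N assms(2) D b vR W by (intro mult_mono divide_left_mono) auto
          also have "\<dots> = 9 / a * (D + b * D) * vR" using N assms(2) by (simp add: field_simps)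
          finally have "mult_risk n \<theta> (plugin_test r (sparsity_estimator r) n) \<le> C2 * vR"
            using risks(2) W_le unfolding C2_def distrib_right[of _ 2] by linarith
          also have "\<dots> \<le> (C1 + C2) * v_R n r \<beta>"
            unfolding vR_def[symmetric] using C vR by (intro mult_right_mono) auto
          finally show ?thesis using 1 by blast
        qed
        show "(SUP \<theta>\<in>Theta a b n r \<beta>. ereal (classif_risk n \<theta> (plugin_test r (sparsity_estimator r) n)))
              \<le> ereal ((C1 + C2) * v_C n r \<beta>) \<and>
            (SUP \<theta>\<in>Theta a b n r \<beta>. ereal (mult_risk n \<theta> (plugin_test r (sparsity_estimator r) n)))
              \<le> ereal ((C1 + C2) * v_R n r \<beta>)"
          using * by (auto intro!: SUP_least)
      qed
    qed
  qed (use C in simp)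
qed

end
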